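(* Let $F$ be a field and let $X$ be a nonempty quasicompact subset of $\mathrm{Zar}(F)$ (in the Zariski topology) consisting of rank one valuation rings, such that $\bigcap_{V\in X}\mathfrak{M}_V\neq 0$. Then $\bigcap_{V\in X}V$ is an integral domain with quotient field $F$ and Krull dimension one such that every finitely generated ideal is a principal ideal.
   Context: For a field $F$, $\mathrm{Zar}(F)$ denotes the set of valuation rings of $F$, i.e. the subrings $V$ of $F$ such that for all $0\neq t\in F$, $t\in V$ or $t^{-1}\in V$ (so $F\in\mathrm{Zar}(F)$). The Zariski topology on $\mathrm{Zar}(F)$ has as a basis of open sets the sets $\{V\in\mathrm{Zar}(F): x_1,\ldots,x_n\in V\}$ with $x_1,\ldots,x_n\in F$; subsets carry the subspace topology. Quasicompact means every open cover has a finite subcover. The rank of a valuation ring is its Krull dimension when the latter is at most one; in particular a rank one valuation ring is a valuation ring of Krull dimension one (its value group is a nonzero subgroup of $\mathbb{R}$). $\mathfrak{M}_V$ denotes the maximal ideal of a valuation ring $V$. *)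

theory Defs
  imports
    "HOL-Analysis.Abstract_Topology"
    "HOL-Library.Extended_Nat"
    "HOL-Algebra.Subrings"
    "HOL-Algebra.Ideal"
begin

text \<open>
  A subring of a field \<open>F\<close> is represented by its carrier set; regarded as a ring in its own right it
  is \<open>subring_of F A\<close>, so that ideals, prime ideals, etc. are those of the subring and not of \<open>F\<close>.
\<close>

abbreviation subring_of :: "('a, 'b) ring_scheme \<Rightarrow> 'a set \<Rightarrow> ('a, 'b) ring_scheme" where
  "subring_of F A \<equiv> F\<lparr>carrier := A\<rparr>"

definition valuation_ring :: "('a, 'b) ring_scheme \<Rightarrow> 'a set \<Rightarrow> bool" where
  "valuation_ring F V \<longleftrightarrow>
     subring V F \<and> (\<forall>t\<in>carrier F. t \<noteq> \<zero>\<^bsub>F\<^esub> \<longrightarrow> t \<in> V \<or> inv\<^bsub>F\<^esub> t \<in> V)"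

definition Zar :: "('a, 'b) ring_scheme \<Rightarrow> 'a set set" where
  "Zar F = {V. valuation_ring F V}"

definition zariski_basis :: "('a, 'b) ring_scheme \<Rightarrow> 'a set set set" where
  "zariski_basis F = {{V \<in> Zar F. S \<subseteq> V} | S. finite S \<and> S \<subseteq> carrier F}"

definition zariski_topology :: "('a, 'b) ring_scheme \<Rightarrow> 'a set topology" where
  "zariski_topology F = topology_generated_by (zariski_basis F)"

text \<open>
  The Krull dimension is the supremum of the lengths \<open>n\<close> of chains \<open>P 0 \<subset> \<dots> \<subset> P n\<close> of prime ideals.
  The zero ring, which has no prime ideals, gets dimension \<open>0\<close> here because \<open>enat\<close> has no
  negative values.
\<close>

definition krull_dim :: "('a, 'b) ring_scheme \<Rightarrow> enat" where
  "krull_dim R = Sup {enat n | n. \<exists>P :: nat \<Rightarrow> 'a set.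
     (\<forall>i\<le>n. primeideal (P i) R) \<and> (\<forall>i<n. P i \<subset> P (Suc i))}"

definition rank_one_valuation_ring :: "('a, 'b) ring_scheme \<Rightarrow> 'a set \<Rightarrow> bool" where
  "rank_one_valuation_ring F V \<longleftrightarrow> valuation_ring F V \<and> krull_dim (subring_of F V) = 1"

definition max_ideal :: "('a, 'b) ring_scheme \<Rightarrow> 'a set \<Rightarrow> 'a set" where
  "max_ideal F V = (THE M. maximalideal M (subring_of F V))"

definition has_quotient_field :: "'a set \<Rightarrow> ('a, 'b) ring_scheme \<Rightarrow> bool" where
  "has_quotient_field A F \<longleftrightarrow>
     field F \<and> subring A F \<and>
     carrier F = {a \<otimes>\<^bsub>F\<^esub> inv\<^bsub>F\<^esub> b | a b. a \<in> A \<and> b \<in> A \<and> b \<noteq> \<zero>\<^bsub>F\<^esub>}"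

definition fin_gen_ideal :: "'a set \<Rightarrow> ('a, 'b) ring_scheme \<Rightarrow> bool" where
  "fin_gen_ideal I R \<longleftrightarrow> (\<exists>S. finite S \<and> S \<subseteq> carrier R \<and> I = Idl\<^bsub>R\<^esub> S)"

text \<open>The generating family of the topology is a basis, not just a subbasis.\<close>

lemma zariski_basis_Int:
  assumes "B \<in> zariski_basis F" "C \<in> zariski_basis F"
  shows "B \<inter> C \<in> zariski_basis F"
proof -
  obtain S T where
    ST: "finite S" "S \<subseteq> carrier F" "B = {V \<in> Zar F. S \<subseteq> V}"
    "finite T" "T \<subseteq> carrier F" "C = {V \<in> Zar F. T \<subseteq> V}"
    using assms unfolding zariski_basis_def by blast
  have "B \<inter> C = {V \<in> Zar F. S \<union> T \<subseteq> V}" "finite (S \<union> T)" "S \<union> T \<subseteq> carrier F"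
    unfolding ST(3,6) using ST(1,2,4,5) by blast+
  then show ?thesis unfolding zariski_basis_def by blast
qed

lemma openin_zariski_iff:
  "openin (zariski_topology F) U \<longleftrightarrow> (\<exists>\<B>\<subseteq>zariski_basis F. U = \<Union>\<B>)"
proof
  assume "openin (zariski_topology F) U"
  then have "generate_topology_on (zariski_basis F) U"
    by (simp add: zariski_topology_def openin_topology_generated_by_iff)
  then show "\<exists>\<B>\<subseteq>zariski_basis F. U = \<Union>\<B>"
  proof induction
    case Empty
    show ?case by (rule exI[of _ "{}"]) simp
  next
    case (Int a b)
    then obtain \<B> \<C> where BC: "\<B> \<subseteq> zariski_basis F" "a = \<Union>\<B>" "\<C> \<subseteq> zariski_basis F" "b = \<Union>\<C>"
      by blast
    let ?D = "{B \<inter> C | B C. B \<in> \<B> \<and> C \<in> \<C>}"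
    have "?D \<subseteq> zariski_basis F"
      using BC(1,3) zariski_basis_Int by blast
    moreover have "a \<inter> b = \<Union>?D"
      unfolding BC(2,4) by blast
    ultimately show ?case by blast
  next
    case (UN K)
    have "\<forall>k\<in>K. \<exists>\<B>. \<B> \<subseteq> zariski_basis F \<and> \<Union>\<B> = k"
      using UN.IH by metis
    from bchoice[OF this] obtain f
      where f: "\<forall>k\<in>K. f k \<subseteq> zariski_basis F \<and> \<Union>(f k) = k" ..
    have "(\<Union>k\<in>K. f k) \<subseteq> zariski_basis F"
      using f by blast
    moreover have "\<Union>K = \<Union>(\<Union>k\<in>K. f k)"
    proof -
      have "\<Union>(\<Union>k\<in>K. f k) = (\<Union>k\<in>K. \<Union>(f k))" by (rule UN_UN_flatten[where C = "\<lambda>x. x", simplified])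
      also have "\<dots> = \<Union>K" using f by simp
      finally show ?thesis by (rule sym)
    qed
    ultimately show ?case by blast
  next
    case (Basis s)
    then show ?case by (intro exI[of _ "{s}"]) simp
  qed
next
  assume "\<exists>\<B>\<subseteq>zariski_basis F. U = \<Union>\<B>"
  then obtain \<B> where B: "\<B> \<subseteq> zariski_basis F" "U = \<Union>\<B>" by blast
  show "openin (zariski_topology F) U"
    unfolding zariski_topology_def openin_topology_generated_by_iff B(2)
    by (rule generate_topology_on.UN) (use B(1) in \<open>blast intro: generate_topology_on.Basis\<close>)
qed

lemma topspace_zariski_topology: "topspace (zariski_topology F) = Zar F"
proof -
  have "Zar F \<in> zariski_basis F"
    unfolding zariski_basis_def by (rule CollectI, rule exI[of _ "{}"]) simp
  moreover have "\<Union>(zariski_basis F) \<subseteq> Zar F"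
    unfolding zariski_basis_def by blast
  ultimately have "\<Union>(zariski_basis F) = Zar F" by blast
  then show ?thesis
    by (simp add: zariski_topology_def topology_generated_by_topspace)
qed

text \<open>A valuation ring is local, so that \<open>max_ideal\<close> is well defined.\<close>

lemma valuation_ring_maximalideal_iff:
  assumes F: "field F" and V: "valuation_ring F V"
  shows "maximalideal M (subring_of F V) \<longleftrightarrow> M = V - Units (subring_of F V)"
proof -
  interpret F: field F by (rule F)
  have sub: "subring V F"
    and val: "\<And>t. t \<in> carrier F \<Longrightarrow> t \<noteq> \<zero>\<^bsub>F\<^esub> \<Longrightarrow> t \<in> V \<or> inv\<^bsub>F\<^esub> t \<in> V"
    using V by (auto simp: valuation_ring_def)
  have VF: "x \<in> carrier F" if "x \<in> V" for x
    using subringE(1)[OF sub] that by blast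
  define R where "R = subring_of F V"
  have R_simps: "carrier R = V" "mult R = mult F" "add R = add F" "one R = one F" "zero R = zero F"
    by (simp_all add: R_def)
  interpret R: cring R
    unfolding R_def by (rule F.subcring_iff[THEN iffD1, OF subringE(1)[OF sub]])
      (rule F.subcringI'[OF sub])
  define N where "N = V - Units R"
  have unit_mult: "b \<in> Units R" if a: "a \<in> V" and b: "b \<in> V" and u: "a \<otimes>\<^bsub>R\<^esub> b \<in> Units R" for a b
  proof -
    have aR: "a \<in> carrier R" and bR: "b \<in> carrier R" using a b by (simp_all only: R_simps(1))
    let ?y = "inv\<^bsub>R\<^esub> (a \<otimes>\<^bsub>R\<^esub> b) \<otimes>\<^bsub>R\<^esub> a"
    have y: "?y \<in> carrier R" using u aR by simp
    have yb: "?y \<otimes>\<^bsub>R\<^esub> b = \<one>\<^bsub>R\<^esub>"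
      using R.m_assoc[OF _ aR bR, of "inv\<^bsub>R\<^esub> (a \<otimes>\<^bsub>R\<^esub> b)"] R.Units_l_inv[OF u] R.Units_inv_closed[OF u]
      by simp
    moreover have "b \<otimes>\<^bsub>R\<^esub> ?y = \<one>\<^bsub>R\<^esub>"
      using R.m_comm[OF y bR] yb by simp
    ultimately show ?thesis using y bR unfolding Units_def by blast
  qed
  have N_mult: "x \<otimes>\<^bsub>R\<^esub> a \<in> N" if "a \<in> N" "x \<in> V" for a x
    using that unit_mult[of x a] R.m_closed[of x a] by (auto simp: N_def R_simps)
  have N0: "\<zero>\<^bsub>R\<^esub> \<in> N"
  proof -
    have "\<zero>\<^bsub>R\<^esub> \<notin> Units R"
    proof
      assume "\<zero>\<^bsub>R\<^esub> \<in> Units R"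
      then obtain y where "y \<in> carrier R" "y \<otimes>\<^bsub>R\<^esub> \<zero>\<^bsub>R\<^esub> = \<one>\<^bsub>R\<^esub>"
        unfolding Units_def by blast
      then have "\<zero>\<^bsub>R\<^esub> = \<one>\<^bsub>R\<^esub>" using R.r_null by simp
      then show False using F.one_not_zero by (simp add: R_simps(4,5))
    qed
    then show ?thesis using R.zero_closed by (simp add: N_def R_simps)
  qed
  have N_add_aux: "a \<oplus>\<^bsub>R\<^esub> b \<in> N"
    if a: "a \<in> N" and b: "b \<in> N" and b0: "b \<noteq> \<zero>\<^bsub>F\<^esub>" and c: "a \<otimes>\<^bsub>F\<^esub> inv\<^bsub>F\<^esub> b \<in> V" for a b
  proof -
    have aF: "a \<in> carrier F" and bF: "b \<in> carrier F" and bU: "b \<in> Units F"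
      using a b b0 VF by (auto simp: N_def F.field_Units)
    let ?c = "a \<otimes>\<^bsub>F\<^esub> inv\<^bsub>F\<^esub> b"
    have "a = ?c \<otimes>\<^bsub>R\<^esub> b"
      using aF bF bU by (simp add: R_simps F.m_assoc)
    then have "a \<oplus>\<^bsub>R\<^esub> b = (?c \<oplus>\<^bsub>R\<^esub> \<one>\<^bsub>R\<^esub>) \<otimes>\<^bsub>R\<^esub> b"
      using R.l_distr[of ?c "\<one>\<^bsub>R\<^esub>" b] R.l_one[of b] R.one_closed b c
      unfolding R_simps(1) N_def by simp
    moreover have "?c \<oplus>\<^bsub>R\<^esub> \<one>\<^bsub>R\<^esub> \<in> V"
      using R.a_closed[of ?c "\<one>\<^bsub>R\<^esub>"] R.one_closed c by (simp only: R_simps(1))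
    ultimately show ?thesis using N_mult[OF b] by simp
  qed
  have N_add: "a \<oplus>\<^bsub>R\<^esub> b \<in> N" if a: "a \<in> N" and b: "b \<in> N" for a b
  proof -
    have aV: "a \<in> V" and bV: "b \<in> V" using a b by (auto simp: N_def)
    have aF: "a \<in> carrier F" and bF: "b \<in> carrier F" using aV bV VF by auto
    consider "a = \<zero>\<^bsub>F\<^esub>" | "b = \<zero>\<^bsub>F\<^esub>" | "a \<noteq> \<zero>\<^bsub>F\<^esub>" "b \<noteq> \<zero>\<^bsub>F\<^esub>" by blast
    then show ?thesis
    proof cases
      case 1
      then show ?thesis using b bF by (simp add: R_simps)
    next
      case 2
      then show ?thesis using a aF by (simp add: R_simps)
    next
      case 3
      then have aU: "a \<in> Units F" and bU: "b \<in> Units F"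
        using aF bF by (auto simp: F.field_Units)
      let ?t = "a \<otimes>\<^bsub>F\<^esub> inv\<^bsub>F\<^esub> b"
      have t: "?t \<in> Units F" using aU bU by simp
      then have "?t \<in> carrier F" "?t \<noteq> \<zero>\<^bsub>F\<^esub>" by (auto simp: F.field_Units)
      then consider "?t \<in> V" | "inv\<^bsub>F\<^esub> ?t \<in> V" using val by blast
      then show ?thesis
      proof cases
        case 1
        then show ?thesis using N_add_aux[OF a b] 3 by blast
      next
        case 2
        have "inv\<^bsub>F\<^esub> ?t = b \<otimes>\<^bsub>F\<^esub> inv\<^bsub>F\<^esub> a"
        proof (rule F.comm_inv_char)
          have "?t \<otimes>\<^bsub>F\<^esub> (b \<otimes>\<^bsub>F\<^esub> inv\<^bsub>F\<^esub> a) = a \<otimes>\<^bsub>F\<^esub> ((inv\<^bsub>F\<^esub> b \<otimes>\<^bsub>F\<^esub> b) \<otimes>\<^bsub>F\<^esub> inv\<^bsub>F\<^esub> a)"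
            using aU bU aF bF F.Units_inv_closed by (simp only: F.m_assoc F.m_closed)
          also have "\<dots> = \<one>\<^bsub>F\<^esub>" using aU bU by simp
          finally show "?t \<otimes>\<^bsub>F\<^esub> (b \<otimes>\<^bsub>F\<^esub> inv\<^bsub>F\<^esub> a) = \<one>\<^bsub>F\<^esub>" .
        qed (use aU bU aF bF in simp_all)
        then have "b \<oplus>\<^bsub>R\<^esub> a \<in> N" using N_add_aux[OF b a] 2 3 by simp
        then show ?thesis using R.a_comm[of a b] aV bV by (simp add: R_simps(1))
      qed
    qed
  qed
  have NV: "N \<subseteq> carrier R" by (auto simp: N_def R_simps)
  have N_ideal: "ideal N R"
  proof (rule idealI)
    show "ring R" by (rule R.ring_axioms)
    show "subgroup N (add_monoid R)"
    proof (rule group.subgroupI[OF R.a_group])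
      show "N \<subseteq> carrier (add_monoid R)" using NV by simp
      show "N \<noteq> {}" using N0 by blast
      fix a assume a: "a \<in> N"
      then have aV: "a \<in> carrier R" using NV by blast
      have "(\<ominus>\<^bsub>R\<^esub> \<one>\<^bsub>R\<^esub>) \<otimes>\<^bsub>R\<^esub> a \<in> N"
        using N_mult[OF a, of "\<ominus>\<^bsub>R\<^esub> \<one>\<^bsub>R\<^esub>"] R.a_inv_closed[OF R.one_closed] by (simp only: R_simps(1))
      then have "\<ominus>\<^bsub>R\<^esub> a \<in> N"
        using R.l_minus[OF R.one_closed aV] R.l_one[OF aV] by simp
      then show "inv\<^bsub>add_monoid R\<^esub> a \<in> N" by (simp add: a_inv_def)
    next
      fix a b assume "a \<in> N" "b \<in> N"
      then show "a \<otimes>\<^bsub>add_monoid R\<^esub> b \<in> N" using N_add by simp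
    qed
    fix a x assume a: "a \<in> N" and x: "x \<in> carrier R"
    show "x \<otimes>\<^bsub>R\<^esub> a \<in> N" using N_mult a x by (simp only: R_simps(1))
    then show "a \<otimes>\<^bsub>R\<^esub> x \<in> N" using R.m_comm[of a x] a x NV by auto
  qed
  have one_Units: "\<one>\<^bsub>R\<^esub> \<in> Units R" by simp
  have N_proper: "carrier R \<noteq> N" using one_Units R.one_closed by (auto simp: N_def)
  have no_unit: "J \<subseteq> N" if J: "ideal J R" "J \<noteq> carrier R" for J
  proof
    interpret J: ideal J R by (rule J(1))
    fix x assume x: "x \<in> J"
    have "x \<notin> Units R"
    proof
      assume "x \<in> Units R"
      then have "\<one>\<^bsub>R\<^esub> \<in> J"
        using J.I_l_closed[OF x, of "inv\<^bsub>R\<^esub> x"] by simp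
      then show False using J.one_imp_carrier J(2) by simp
    qed
    then show "x \<in> N" using J.a_subset x by (auto simp: N_def R_simps)
  qed
  have "maximalideal M R \<longleftrightarrow> M = N"
  proof
    assume "maximalideal M R"
    then interpret M: maximalideal M R .
    have "M \<subseteq> N" using no_unit M.ideal_axioms M.I_notcarr by blast
    then show "M = N" using M.I_maximal[OF N_ideal _ NV] N_proper by blast
  next
    assume "M = N"
    moreover have "maximalideal N R"
    proof (rule maximalidealI[OF N_ideal N_proper])
      fix J assume "ideal J R" "N \<subseteq> J" "J \<subseteq> carrier R"
      then show "J = N \<or> J = carrier R" using no_unit by blast
    qed
    ultimately show "maximalideal M R" by simp
  qed
  then show ?thesis by (simp add: N_def R_def)
qed

lemma max_ideal_valuation_ring:
  assumes "field F" "valuation_ring F V"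
  shows "maximalideal (max_ideal F V) (subring_of F V)"
  unfolding max_ideal_def valuation_ring_maximalideal_iff[OF assms] by (rule theI) (rule refl)

end

theory Submission
  imports Defs
begin

text \<open>
  Write \<open>A\<close> for the intersection of the rings in \<open>X\<close>, \<open>J\<close> for the intersection of their maximal
  ideals \<open>M\<^sub>V\<close>, and fix \<open>0 \<noteq> t \<in> J\<close>. Two properties of \<open>X\<close> are used. Since each \<open>V \<in> X\<close> has rank one,
  every element of \<open>F\<close> is pushed into \<open>V\<close> by a power of any nonzero element of \<open>M\<^sub>V\<close>
  (\<open>archimedean\<close>). Quasicompactness says that a subset of \<open>F\<close> which meets every member of \<open>X\<close> has a
  finite subset which does so as well (\<open>finite_transversal\<close>). Together they make exponents uniform
  over \<open>X\<close>. For instance some \<open>t\<^sup>n x\<close> lies in \<open>A\<close> for each \<open>x\<close> in \<open>F\<close>, so that \<open>F\<close> is the quotient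
  field of \<open>A\<close>, and every nonzero prime ideal of \<open>A\<close> contains \<open>t\<close>, hence \<open>J\<close>.

  The central construction (\<open>approximate_indicator\<close>) attaches to \<open>x \<in> F\<close> the element
  \<open>w = 1 / (1 + t x\<^sup>m\<^sup>+\<^sup>1)\<close>. Let \<open>v\<close> be the valuation of \<open>V\<close>. If \<open>v(x) \<ge> 0\<close>, then \<open>w\<close> is congruent to \<open>1\<close>
  modulo \<open>M\<^sub>V\<close>. If \<open>v(x) < 0\<close> and \<open>m\<close> is so large that \<open>v(t x\<^sup>m) < 0\<close>, then \<open>w\<close> and \<open>x w\<close> lie in \<open>M\<^sub>V\<close>.
  By quasicompactness one \<open>m\<close> serves for all \<open>V \<in> X\<close> at once. Hence \<open>w\<close> behaves modulo \<open>J\<close> like the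
  indicator function of \<open>{V \<in> X. x \<in> V}\<close>. This has two consequences.

  Firstly, \<open>A / J\<close> is von Neumann regular: for \<open>0 \<noteq> a \<in> A\<close> apply the construction to \<open>x = 1 / a\<close>; then
  \<open>b = x w\<close> satisfies \<open>a (1 - a b) \<in> J\<close> (\<open>regular_modulo_J\<close>). So no two distinct primes above \<open>J\<close> are
  comparable, and \<open>A\<close> has dimension one. Moreover, two elements of \<open>A\<close> which generate the unit ideal
  in every \<open>V \<in> X\<close> do so in \<open>A\<close> (\<open>comaximal\<close>).

  Secondly, let \<open>a, b \<in> A\<close> with \<open>b \<noteq> 0\<close>, put \<open>x = a / b\<close> and let \<open>q = (1 + t x\<^sup>m) / (1 + t x\<^sup>m\<^sup>+\<^sup>1)\<close>. Then
  \<open>v(1 / q) = min(v(x), 0)\<close> for all \<open>V \<in> X\<close>, so \<open>b / q\<close> generates the ideal of \<open>a\<close> and \<open>b\<close> in each \<open>V\<close>.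
  Equivalently, \<open>p = x q\<close> and \<open>q\<close> belong to \<open>A\<close> and generate the unit ideal in each \<open>V\<close>, hence in \<open>A\<close>.
  From \<open>r p + s q = 1\<close> and \<open>p b = q a\<close> it follows that \<open>r a + s b\<close> generates the ideal of \<open>a\<close> and \<open>b\<close>
  in \<open>A\<close> (\<open>gcd_exists\<close>).
\<close>

section \<open>Inverses in a field and ideals of subrings\<close>

lemma (in field) inv_nonzero [simp]:
  assumes "x \<in> carrier R" "x \<noteq> \<zero>"
  shows "inv x \<in> carrier R" "inv x \<noteq> \<zero>" "x \<otimes> inv x = \<one>" "inv x \<otimes> x = \<one>" "inv (inv x) = x"
proof -
  have "x \<in> Units R" using assms by (simp add: field_Units)
  then have "inv x \<in> Units R" "x \<otimes> inv x = \<one>" "inv x \<otimes> x = \<one>" "inv (inv x) = x" by simp_all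
  then show "inv x \<in> carrier R" "inv x \<noteq> \<zero>" "x \<otimes> inv x = \<one>" "inv x \<otimes> x = \<one>" "inv (inv x) = x"
    by (simp_all add: field_Units)
qed

lemma (in field) inv_prod:
  assumes "x \<in> carrier R" "y \<in> carrier R" "x \<noteq> \<zero>" "y \<noteq> \<zero>"
  shows "inv (x \<otimes> y) = inv x \<otimes> inv y"
proof (rule comm_inv_char)
  have "(x \<otimes> y) \<otimes> (inv x \<otimes> inv y) = (x \<otimes> inv x) \<otimes> (y \<otimes> inv y)"
    using assms by (simp add: m_ac del: inv_nonzero(3,4))
  then show "(x \<otimes> y) \<otimes> (inv x \<otimes> inv y) = \<one>" using assms by simp
qed (use assms in simp_all)

lemma (in field) nat_pow_nonzero: "x \<in> carrier R \<Longrightarrow> x \<noteq> \<zero> \<Longrightarrow> x [^] (n::nat) \<noteq> \<zero>"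
  by (induction n) (simp_all add: integral_iff)

lemma (in field) inv_cancel:
  assumes "x \<in> carrier R" "x \<noteq> \<zero>" "y \<in> carrier R"
  shows "x \<otimes> (inv x \<otimes> y) = y" "inv x \<otimes> (x \<otimes> y) = y"
  using assms by (simp_all flip: m_assoc)

lemma (in domain) subring_idealI:
  assumes "subring A R" "P \<subseteq> A" "\<zero> \<in> P" "\<And>x y. x \<in> P \<Longrightarrow> y \<in> P \<Longrightarrow> x \<oplus> y \<in> P"
    "\<And>x y. x \<in> P \<Longrightarrow> y \<in> A \<Longrightarrow> y \<otimes> x \<in> P"
  shows "ideal P (subring_of R A)"
proof -
  interpret A: domain "subring_of R A" by (rule subring_is_domain[OF assms(1)])
  show ?thesis
  proof (rule idealI)
    show "subgroup P (add_monoid (subring_of R A))"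
    proof (rule group.subgroupI[OF A.a_group])
      fix x assume x: "x \<in> P"
      then have "x \<in> A" using assms(2) by blast
      then have "\<ominus>\<^bsub>subring_of R A\<^esub> x = (\<ominus>\<^bsub>subring_of R A\<^esub> \<one>) \<otimes> x"
        using A.l_minus[of \<one> x] subringE(3)[OF assms(1)] subringE(1)[OF assms(1)] by auto
      also have "\<dots> \<in> P" using A.a_inv_closed[OF A.one_closed] assms(5)[OF x] by simp
      finally show "inv\<^bsub>add_monoid (subring_of R A)\<^esub> x \<in> P" by (simp add: a_inv_def)
    qed (use assms in auto)
    fix a x assume a: "a \<in> P" and x: "x \<in> carrier (subring_of R A)"
    show "x \<otimes>\<^bsub>subring_of R A\<^esub> a \<in> P" using assms(5)[OF a] x by simp
    then show "a \<otimes>\<^bsub>subring_of R A\<^esub> x \<in> P"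
      using A.m_comm[of a x] a x assms(2) by auto
  qed (rule A.ring_axioms)
qed

lemma (in domain) subring_primeidealI:
  assumes "subring A R" "P \<subseteq> A" "\<zero> \<in> P" "\<And>x y. x \<in> P \<Longrightarrow> y \<in> P \<Longrightarrow> x \<oplus> y \<in> P"
    "\<And>x y. x \<in> P \<Longrightarrow> y \<in> A \<Longrightarrow> y \<otimes> x \<in> P"
    "\<one> \<notin> P" "\<And>x y. x \<in> A \<Longrightarrow> y \<in> A \<Longrightarrow> x \<otimes> y \<in> P \<Longrightarrow> x \<in> P \<or> y \<in> P"
  shows "primeideal P (subring_of R A)"
proof (rule primeidealI)
  show "ideal P (subring_of R A)" by (rule subring_idealI[OF assms(1-5)])
  show "cring (subring_of R A)"
    using subring_is_domain[OF assms(1)] by (simp add: domain_def)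
  show "carrier (subring_of R A) \<noteq> P" using assms(6) subringE(3)[OF assms(1)] by auto
qed (use assms(7) in simp)

lemma krull_dim_ge:
  assumes "\<And>i. i \<le> n \<Longrightarrow> primeideal (P i) R" "\<And>i. i < n \<Longrightarrow> P i \<subset> P (Suc i)"
  shows "enat n \<le> krull_dim R"
  unfolding krull_dim_def by (rule Sup_upper) (use assms in blast)

section \<open>Valuation rings\<close>

locale valuation_subring = field R for R (structure) +
  fixes V
  assumes valuation_ring: "valuation_ring R V"
begin

abbreviation M where "M \<equiv> max_ideal R V"

lemma subring: "subring V R"
  using valuation_ring by (simp add: valuation_ring_def)

lemmas V_closed [simp, intro] = subringE(2,3)[OF subring] subringE(5-7)[OF subring]

lemma V_carrier [simp, dest]: "x \<in> V \<Longrightarrow> x \<in> carrier R"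
  using subringE(1)[OF subring] by blast

lemma inv_mem: "x \<in> carrier R \<Longrightarrow> x \<notin> V \<Longrightarrow> inv x \<in> V"
  using valuation_ring V_closed(1) by (auto simp: valuation_ring_def)

lemma V_pow [simp]: "x \<in> V \<Longrightarrow> x [^] (n::nat) \<in> V"
  by (induction n) simp_all

lemma maximal: "maximalideal M (subring_of R V)"
  by (rule max_ideal_valuation_ring) (use field_axioms valuation_ring in auto)

lemma M_iff: "x \<in> M \<longleftrightarrow> x \<in> V \<and> (x = \<zero> \<or> inv x \<notin> V)"
proof -
  have "M = V - Units (subring_of R V)"
    using maximal valuation_ring_maximalideal_iff[OF field_axioms valuation_ring] by simp
  moreover have "x \<in> Units (subring_of R V) \<longleftrightarrow> x \<in> V \<and> x \<noteq> \<zero> \<and> inv x \<in> V"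
  proof
    assume "x \<in> Units (subring_of R V)"
    then obtain y where y: "y \<in> V" "x \<in> V" "x \<otimes> y = \<one>" "y \<otimes> x = \<one>"
      by (auto simp: Units_def)
    then have "inv x = y" by (intro comm_inv_char) auto
    moreover have "x \<noteq> \<zero>" using y by auto
    ultimately show "x \<in> V \<and> x \<noteq> \<zero> \<and> inv x \<in> V" using y by simp
  next
    assume x: "x \<in> V \<and> x \<noteq> \<zero> \<and> inv x \<in> V"
    then show "x \<in> Units (subring_of R V)"
      unfolding Units_def by (auto intro!: bexI[of _ "inv x"])
  qed
  ultimately show ?thesis by blast
qed

lemma M_V [simp, dest]: "x \<in> M \<Longrightarrow> x \<in> V"
  using M_iff by blast

lemma zero_M [simp]: "\<zero> \<in> M"
  using M_iff V_closed(1) by blast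

lemma one_M [simp]: "\<one> \<notin> M"
  by (simp add: M_iff del: M_V)

lemma M_mult [simp]:
  assumes "x \<in> M" "y \<in> V" shows "x \<otimes> y \<in> M" "y \<otimes> x \<in> M"
proof -
  interpret m: maximalideal M "subring_of R V" by (rule maximal)
  show "x \<otimes> y \<in> M" "y \<otimes> x \<in> M"
    using m.I_r_closed[of x y] m.I_l_closed[of x y] assms by simp_all
qed

lemma M_add [simp]:
  assumes "x \<in> M" "y \<in> M" shows "x \<oplus> y \<in> M"
proof -
  interpret m: maximalideal M "subring_of R V" by (rule maximal)
  show ?thesis using additive_subgroup.a_closed[OF m.is_additive_subgroup assms] by simp
qed

lemma M_minus: assumes "x \<in> M" shows "\<ominus> x \<in> M"
proof -
  have "(\<ominus> \<one>) \<otimes> x \<in> M" using assms by simp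
  moreover have "(\<ominus> \<one>) \<otimes> x = \<ominus> x" using assms by (simp add: l_minus)
  ultimately show ?thesis by simp
qed

lemma one_plus_M: assumes "x \<in> M" shows "\<one> \<oplus> x \<notin> M"
proof
  assume "\<one> \<oplus> x \<in> M"
  then have "(\<one> \<oplus> x) \<oplus> (\<ominus> x) \<in> M" using M_minus[OF assms] by simp
  moreover have "(\<one> \<oplus> x) \<oplus> (\<ominus> x) = \<one>" using assms by (simp add: a_assoc r_neg)
  ultimately show False by simp
qed

lemma notin_V:
  assumes "x \<in> carrier R" "x \<notin> V" shows "x \<noteq> \<zero> \<and> inv x \<in> M"
proof -
  have "x \<noteq> \<zero>" using assms V_closed(1) by blast
  then show ?thesis using inv_mem[OF assms] assms by (simp add: M_iff del: M_V)
qed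

lemma unit: "x \<in> V \<Longrightarrow> x \<notin> M \<Longrightarrow> x \<noteq> \<zero> \<and> inv x \<in> V"
  by (auto simp: M_iff simp del: M_V)

lemma notin_V_mult:
  assumes "x \<in> carrier R" "y \<in> carrier R" "x \<notin> V" "y \<notin> V"
  shows "x \<otimes> y \<notin> V"
proof -
  have "x \<noteq> \<zero>" "y \<noteq> \<zero>" "inv x \<otimes> inv y \<in> M" using notin_V assms by auto
  then have "inv (x \<otimes> y) \<in> M" "x \<otimes> y \<noteq> \<zero>" using assms by (simp_all add: inv_prod integral_iff)
  then show ?thesis using assms by (simp add: M_iff del: M_V)
qed

lemma prime_M: assumes "x \<in> V" "y \<in> V" "x \<otimes> y \<in> M" shows "x \<in> M \<or> y \<in> M"
proof (rule ccontr)
  assume "\<not> (x \<in> M \<or> y \<in> M)"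
  then have *: "x \<noteq> \<zero>" "y \<noteq> \<zero>" "inv x \<in> V" "inv y \<in> V" using unit assms by auto
  then have "inv (x \<otimes> y) \<in> V" "x \<otimes> y \<noteq> \<zero>" using assms by (simp_all add: inv_prod integral_iff)
  then show False using assms by (simp add: M_iff del: M_V)
qed

lemma notin_V_add:
  assumes "x \<in> V" "y \<in> carrier R" "y \<notin> V" shows "x \<oplus> y \<notin> V"
proof
  assume "x \<oplus> y \<in> V"
  then have "\<ominus> x \<oplus> (x \<oplus> y) \<in> V" using assms by auto
  moreover have "\<ominus> x \<oplus> (x \<oplus> y) = y" using assms by (simp add: r_neg1)
  ultimately show False using assms by simp
qed


text \<open>
  The next two lemmas describe the elements \<open>1 + t x\<^sup>k\<close>, the future denominators, at a single
  valuation ring: first where \<open>x\<close> is integral, then where it has a pole.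
\<close>

lemma denominator_unit:
  assumes "t \<in> M" "x \<in> V"
  shows "\<one> \<oplus> t \<otimes> x [^] (k::nat) \<in> V" "\<one> \<oplus> t \<otimes> x [^] k \<notin> M"
  using assms by (simp_all add: one_plus_M)

text \<open>
  In terms of the valuation \<open>v\<close>: as \<open>v(x)\<close> and \<open>v(t x\<^sup>k)\<close> are negative, \<open>v(d) = v(x) + v(t x\<^sup>k)\<close> lies below
  both \<open>0\<close> and \<open>v(x)\<close>. The second estimate is read off from \<open>d / x = 1 / x + t x\<^sup>k\<close>.
\<close>

lemma denominator_pole:
  fixes k :: nat
  assumes "t \<in> M" "x \<in> carrier R" "x \<notin> V" "t \<otimes> x [^] k \<notin> V"
  defines "d \<equiv> \<one> \<oplus> t \<otimes> x [^] Suc k"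
  shows "d \<noteq> \<zero>" "inv d \<in> M" "x \<otimes> inv d \<in> M"
proof -
  have c: "t \<in> carrier R" "d \<in> carrier R" using assms by (simp_all add: d_def)
  have x: "x \<noteq> \<zero>" "inv x \<in> V" using notin_V assms by auto
  have "t \<otimes> x [^] k \<otimes> x \<notin> V"
    by (rule notin_V_mult) (use assms(2-4) c in simp_all)
  then have "t \<otimes> x [^] Suc k \<notin> V" using assms c by (simp add: m_assoc)
  then have "d \<notin> V" unfolding d_def using assms c by (intro notin_V_add) auto
  then show d: "d \<noteq> \<zero>" "inv d \<in> M" using notin_V c by auto
  have "inv x \<otimes> d = inv x \<oplus> inv x \<otimes> (x \<otimes> (t \<otimes> x [^] k))"
    using c x assms(2) by (simp add: d_def r_distr m_ac)
  also have "\<dots> = inv x \<oplus> t \<otimes> x [^] k"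
    using c x assms(2) by (simp add: inv_cancel)
  also have "\<dots> \<notin> V" using assms c x by (intro notin_V_add) auto
  finally have "inv (inv x \<otimes> d) \<in> M" using notin_V c x by auto
  then show "x \<otimes> inv d \<in> M" using c d x assms(2) by (simp add: inv_prod)
qed

section \<open>Valuation rings of rank one\<close>

lemma prime_max_ideal: "primeideal M (subring_of R V)"
  by (rule subring_primeidealI) (use subring prime_M in auto)

text \<open>
  The elements divisible by all powers of \<open>t\<close> form a prime ideal. It avoids \<open>t\<close>, so that it can lie
  strictly between \<open>0\<close> and the maximal ideal only in dimension at least two.
\<close>

lemma prime_infinitely_divisible:
  assumes t: "t \<in> M" "t \<noteq> \<zero>"
  shows "primeideal {z \<in> V. \<forall>n::nat. inv (t [^] n) \<otimes> z \<in> V} (subring_of R V)" (is "primeideal ?P _")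
proof (rule subring_primeidealI)
  have tc: "t \<in> carrier R" using t by auto
  note tn = nat_pow_nonzero[OF tc t(2)]
  have ic: "inv (t [^] n) \<in> carrier R" for n :: nat using tc tn by simp
  show "\<zero> \<in> ?P" using ic by simp
  show "x \<oplus> y \<in> ?P" if "x \<in> ?P" "y \<in> ?P" for x y
    using that ic by (simp add: r_distr)
  show "y \<otimes> x \<in> ?P" if "x \<in> ?P" "y \<in> V" for x y
    using that ic by (auto simp: m_lcomm[of _ y x])
  show "\<one> \<notin> ?P"
  proof
    assume "\<one> \<in> ?P"
    then have "inv (t [^] (1::nat)) \<otimes> \<one> \<in> V" by blast
    then show False using t tc by (simp add: M_iff del: M_V)
  qed
  show "x \<in> ?P \<or> y \<in> ?P" if xy: "x \<in> V" "y \<in> V" "x \<otimes> y \<in> ?P" for x y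
  proof (rule ccontr)
    assume "\<not> (x \<in> ?P \<or> y \<in> ?P)"
    then obtain m n :: nat where mn: "inv (t [^] m) \<otimes> x \<notin> V" "inv (t [^] n) \<otimes> y \<notin> V"
      using xy by blast
    have "(inv (t [^] m) \<otimes> x) \<otimes> (inv (t [^] n) \<otimes> y) \<notin> V"
      by (rule notin_V_mult) (use mn ic xy in simp_all)
    moreover have "(inv (t [^] m) \<otimes> x) \<otimes> (inv (t [^] n) \<otimes> y) = inv (t [^] (m + n)) \<otimes> (x \<otimes> y)"
      using ic xy tc tn by (simp add: nat_pow_mult[symmetric] inv_prod m_ac)
    ultimately show False using xy by auto
  qed
qed (use subring in auto)

text \<open>
  If no \<open>t\<^sup>n x\<close> lay in \<open>V\<close>, then \<open>1 / x\<close> would be divisible by all powers of \<open>t\<close>, and the ideal \<open>P\<close> of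
  such elements would give a chain \<open>0 \<subset> P \<subset> M\<close> of primes.
\<close>

lemma archimedean:
  assumes dim: "krull_dim (subring_of R V) = 1" and t: "t \<in> M" "t \<noteq> \<zero>" and x: "x \<in> carrier R"
  shows "\<exists>n::nat. t [^] n \<otimes> x \<in> V"
proof (rule ccontr)
  assume n: "\<nexists>n::nat. t [^] n \<otimes> x \<in> V"
  have tc: "t \<in> carrier R" using t by auto
  note tn = nat_pow_nonzero[OF tc t(2)]
  have ic: "inv (t [^] n) \<in> carrier R" for n :: nat using tc tn by simp
  define P where "P = {z \<in> V. \<forall>n::nat. inv (t [^] n) \<otimes> z \<in> V}"
  have P: "primeideal P (subring_of R V)"
    unfolding P_def by (rule prime_infinitely_divisible[OF t])
  have xV: "x \<notin> V" using n[simplified, rule_format, of 0] x by auto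
  then have x0: "x \<noteq> \<zero>" "inv x \<in> V" using notin_V x by auto
  have "inv (t [^] n) \<otimes> inv x \<in> V" for n :: nat
  proof -
    have "inv (t [^] n \<otimes> x) \<in> V" using n tc x by (intro inv_mem) auto
    then show ?thesis using tc tn x x0 by (simp add: inv_prod)
  qed
  then have "inv x \<in> P" using x0 by (simp add: P_def)
  moreover have "\<zero> \<in> P" using ic by (simp add: P_def)
  ultimately have 1: "{\<zero>} \<subset> P" using x x0 inv_nonzero(2)[of x] by auto
  interpret P: primeideal P "subring_of R V" by (rule P)
  have "t \<notin> P"
  proof
    assume "t \<in> P"
    then have "inv (t [^] (2::nat)) \<otimes> t \<in> V" by (auto simp: P_def)
    moreover have "inv (t [^] (2::nat)) \<otimes> t = inv t"
      using tc t by (simp add: numeral_2_eq_2 inv_prod m_assoc)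
    ultimately show False using t by (simp add: M_iff del: M_V)
  qed
  moreover have "P \<subseteq> M"
  proof
    fix z assume z: "z \<in> P"
    then have "z \<in> V" by (simp add: P_def)
    have "\<one> \<notin> P" using P.one_imp_carrier P.I_notcarr by auto
    have "z \<in> M" if "z \<noteq> \<zero>" "inv z \<in> V"
      using P.I_l_closed[OF z, of "inv z"] that \<open>\<one> \<notin> P\<close> \<open>z \<in> V\<close> by simp
    then show "z \<in> M" using M_iff \<open>z \<in> V\<close> by blast
  qed
  ultimately have 2: "P \<subset> M" using t by blast
  define Q where "Q i = (if i = 0 then {\<zero>} else if i = 1 then P else M)" for i :: nat
  interpret D: domain "subring_of R V" by (rule subring_is_domain[OF subring])
  have "enat 2 \<le> krull_dim (subring_of R V)"
  proof (rule krull_dim_ge[where P = Q])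
    show "primeideal (Q i) (subring_of R V)" for i
      using P prime_max_ideal D.zeroprimeideal by (simp add: Q_def)
    show "Q i \<subset> Q (Suc i)" if "i < 2" for i
    proof -
      have "i = 0 \<or> i = 1" using that by auto
      then show ?thesis using 1 2 by (auto simp: Q_def)
    qed
  qed
  then show False using dim by (simp add: one_enat_def)
qed

end


section \<open>Quasicompact families of rank one valuation rings\<close>

locale rank_one_family = field R for R (structure) +
  fixes X
  assumes nonempty: "X \<noteq> {}"
    and quasicompact: "compactin (zariski_topology R) X"
    and rank_one: "\<And>V. V \<in> X \<Longrightarrow> rank_one_valuation_ring R V"
begin

abbreviation A where "A \<equiv> \<Inter>X"

abbreviation J where "J \<equiv> \<Inter>V\<in>X. max_ideal R V"

lemma member_valuation: "V \<in> X \<Longrightarrow> valuation_subring R V"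
  using rank_one field_axioms
  by (simp add: valuation_subring_def valuation_subring_axioms_def rank_one_valuation_ring_def)

lemma A_subring: "subring A R"
proof (rule subringI)
  note V = subringE[OF valuation_subring.subring[OF member_valuation]]
  show "A \<subseteq> carrier R" using V(1) nonempty by blast
  show "\<one> \<in> A" using V(3) by blast
  fix x y assume x: "x \<in> A" and y: "y \<in> A"
  show "\<ominus> x \<in> A" by (rule InterI) (use V(5) x in blast)
  show "x \<otimes> y \<in> A" by (rule InterI) (use V(6) x y in blast)
  show "x \<oplus> y \<in> A" by (rule InterI) (use V(7) x y in blast)
qed

lemmas A_closed [simp, intro] = subringE(2,3)[OF A_subring] subringE(5-7)[OF A_subring]

lemma A_carrier: "x \<in> A \<Longrightarrow> x \<in> carrier R"
  using subringE(1)[OF A_subring] by blast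

lemma A_pow: "x \<in> A \<Longrightarrow> x [^] (n::nat) \<in> A"
  by (induction n) (simp_all del: Inter_iff)

lemma J_subset_A: "J \<subseteq> A"
  using valuation_subring.M_V[OF member_valuation] by blast

text \<open>
  This is quasicompactness for the cover of \<open>X\<close> by the basic open sets \<open>{V. s \<in> V}\<close> with \<open>s \<in> S\<close>.
\<close>

lemma finite_transversal:
  assumes "S \<subseteq> carrier R" "\<And>V. V \<in> X \<Longrightarrow> S \<inter> V \<noteq> {}"
  obtains T where "finite T" "T \<subseteq> S" "\<And>V. V \<in> X \<Longrightarrow> T \<inter> V \<noteq> {}"
proof -
  define B where "B s = {V \<in> Zar R. {s} \<subseteq> V}" for s
  have "openin (zariski_topology R) (B s)" if "s \<in> S" for s
    unfolding openin_zariski_iff zariski_basis_def B_def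
    using that assms(1) by (intro exI[of _ "{{V \<in> Zar R. {s} \<subseteq> V}}"]) auto
  moreover have "X \<subseteq> \<Union>(B ` S)"
  proof
    fix V assume V: "V \<in> X"
    then have "V \<in> Zar R"
      using rank_one by (simp add: Zar_def rank_one_valuation_ring_def)
    then show "V \<in> \<Union>(B ` S)" using assms(2)[OF V] by (auto simp: B_def)
  qed
  ultimately obtain \<F> where \<F>: "finite \<F>" "\<F> \<subseteq> B ` S" "X \<subseteq> \<Union>\<F>"
    using quasicompact unfolding compactin_def by (metis (no_types, lifting) imageE)
  then obtain T where T: "finite T" "T \<subseteq> S" "\<F> = B ` T"
    by (meson finite_subset_image)
  have "T \<inter> V \<noteq> {}" if "V \<in> X" for V
    using \<F>(3) that T(3) by (auto simp: B_def)
  then show thesis by (rule that[OF T(1,2)])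
qed

text \<open>
  The rings that do not contain \<open>u\<close> form a closed and therefore again quasicompact subset of \<open>X\<close>. Here
  the statement is reduced to the preceding one by adding \<open>u\<close> to the range of \<open>f\<close>.
\<close>

lemma uniform_index:
  fixes f :: "nat \<Rightarrow> 'a"
  assumes "u \<in> carrier R" "\<And>n. f n \<in> carrier R"
    and "\<And>V. V \<in> X \<Longrightarrow> u \<notin> V \<Longrightarrow> \<exists>n. f n \<in> V"
  obtains N where "\<And>V. V \<in> X \<Longrightarrow> u \<notin> V \<Longrightarrow> \<exists>n\<le>N. f n \<in> V"
proof -
  have "insert u (range f) \<subseteq> carrier R" using assms(1,2) by auto
  moreover have "insert u (range f) \<inter> V \<noteq> {}" if "V \<in> X" for V using assms(3)[OF that] by auto
  ultimately obtain T
    where T: "finite T" "T \<subseteq> insert u (range f)" "\<And>V. V \<in> X \<Longrightarrow> T \<inter> V \<noteq> {}"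
    using finite_transversal[of "insert u (range f)"] by metis
  then have "finite (T - {u})" "T - {u} \<subseteq> range f" by auto
  then obtain I where I: "finite I" "T - {u} = f ` I" by (meson finite_subset_image)
  then obtain N where N: "\<And>n. n \<in> I \<Longrightarrow> n \<le> N" by (meson finite_nat_set_iff_bounded_le)
  show thesis
  proof (rule that)
    fix V assume V: "V \<in> X" "u \<notin> V"
    then obtain s where "s \<in> T - {u}" "s \<in> V" using T(3) by blast
    then show "\<exists>n\<le>N. f n \<in> V" using I(2) N by auto
  qed
qed

lemma power_clears_denominator:
  assumes t: "t \<in> J" "t \<noteq> \<zero>" and x: "x \<in> carrier R"
  obtains n :: nat where "t [^] n \<otimes> x \<in> A"
proof -
  have tc: "t \<in> carrier R" using t J_subset_A A_carrier by blast
  have "\<exists>n::nat. t [^] n \<otimes> x \<in> V" if V: "V \<in> X" for V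
    using valuation_subring.archimedean[OF member_valuation[OF V]] rank_one[OF V] t x V
    unfolding rank_one_valuation_ring_def by blast
  then obtain N :: nat
    where N: "\<And>V. V \<in> X \<Longrightarrow> x \<notin> V \<Longrightarrow> \<exists>n\<le>N. t [^] n \<otimes> x \<in> V"
    using uniform_index[of x "\<lambda>n. t [^] n \<otimes> x"] tc x by (metis m_closed nat_pow_closed)
  have "t [^] N \<otimes> x \<in> V" if V: "V \<in> X" for V
  proof -
    interpret V: valuation_subring R V using V by (rule member_valuation)
    have tV: "t \<in> V" using t V by blast
    have "\<exists>n\<le>N. t [^] n \<otimes> x \<in> V"
      using N[OF V] x by (cases "x \<in> V") (auto intro!: exI[of _ 0])
    then obtain n where n: "n \<le> N" "t [^] n \<otimes> x \<in> V" by blast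
    then have "t [^] (N - n) \<otimes> (t [^] n \<otimes> x) \<in> V" using tV by simp
    then show ?thesis using n tc x by (simp add: m_assoc[symmetric] nat_pow_mult)
  qed
  then show thesis using that by blast
qed

text \<open>
  At a ring \<open>V\<close> without \<open>x\<close> the inverse \<open>y\<close> of \<open>x\<close> lies in the maximal ideal, so some \<open>y\<^sup>N / t\<close> lies in
  \<open>V\<close>, where \<open>N\<close> can be chosen independently of \<open>V\<close>. One more factor \<open>y\<close> puts \<open>y\<^sup>N\<^sup>+\<^sup>1 / t\<close> into the maximal
  ideal, which excludes its inverse \<open>t x\<^sup>N\<^sup>+\<^sup>1\<close> from \<open>V\<close>.
\<close>

lemma uniform_pole:
  assumes t: "t \<in> carrier R" "t \<noteq> \<zero>" and x: "x \<in> carrier R"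
  obtains m :: nat where "\<And>V. V \<in> X \<Longrightarrow> x \<notin> V \<Longrightarrow> t \<otimes> x [^] m \<notin> V"
proof (cases "x = \<zero>")
  case True
  then show thesis using that A_closed(1) by blast
next
  case False
  define y where "y = inv x"
  have y: "y \<in> carrier R" "y \<noteq> \<zero>" "x \<otimes> y = \<one>" using False x by (simp_all add: y_def)
  have yM: "y \<in> max_ideal R V" if "V \<in> X" "x \<notin> V" for V
    using valuation_subring.notin_V[OF member_valuation] that x by (simp add: y_def)
  have it: "inv t \<in> carrier R" using t by simp
  have "\<exists>n::nat. y [^] n \<otimes> inv t \<in> V" if V: "V \<in> X" "x \<notin> V" for V
    using valuation_subring.archimedean[OF member_valuation[OF V(1)] _ yM[OF V] y(2) it]
      rank_one[OF V(1)] unfolding rank_one_valuation_ring_def by blast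
  then obtain N :: nat
    where N: "\<And>V. V \<in> X \<Longrightarrow> x \<notin> V \<Longrightarrow> \<exists>n\<le>N. y [^] n \<otimes> inv t \<in> V"
    using uniform_index[of x "\<lambda>n. y [^] n \<otimes> inv t"] y x it by (metis m_closed nat_pow_closed)
  have "t \<otimes> x [^] Suc N \<notin> V" if V: "V \<in> X" "x \<notin> V" for V
  proof
    assume *: "t \<otimes> x [^] Suc N \<in> V"
    interpret V: valuation_subring R V using V by (intro member_valuation)
    obtain n where n: "n \<le> N" "y [^] n \<otimes> inv t \<in> V" using N[OF V] by blast
    have "y [^] (N - n) \<otimes> (y [^] n \<otimes> inv t) \<in> V" using n yM[OF V] by simp
    then have "y [^] N \<otimes> inv t \<in> V" using n y t by (simp add: m_assoc[symmetric] nat_pow_mult)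
    then have "y \<otimes> (y [^] N \<otimes> inv t) \<in> V.M" using yM[OF V] by simp
    then have "(y \<otimes> (y [^] N \<otimes> inv t)) \<otimes> (t \<otimes> x [^] Suc N) \<in> V.M" using * by simp
    moreover have "(y \<otimes> (y [^] N \<otimes> inv t)) \<otimes> (t \<otimes> x [^] Suc N)
        = (t \<otimes> inv t) \<otimes> (x [^] Suc N \<otimes> y [^] Suc N)"
      using x y t by (simp add: m_ac del: inv_nonzero(3,4))
    moreover have "\<dots> = \<one>"
      using x y t nat_pow_distrib[of x y "Suc N", symmetric] nat_pow_one[of "Suc N"]
      by (simp del: nat_pow_Suc)
    ultimately show False by simp
  qed
  then show thesis by (rule that)
qed

text \<open>
  With \<open>d = 1 + t x\<^sup>m\<^sup>+\<^sup>1\<close> and \<open>n = 1 + t x\<^sup>m\<close> the witnesses are \<open>w = 1 / d\<close> and \<open>q = n / d\<close>. The identity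
  between them is \<open>x n = d + x - 1\<close> divided by \<open>d\<close>; at a pole of \<open>x\<close> it shows \<open>x q\<close> to be congruent to
  \<open>1\<close> modulo the maximal ideal.
\<close>

lemma approximate_indicator:
  assumes t: "t \<in> J" "t \<noteq> \<zero>" and x: "x \<in> carrier R"
  obtains w q where "w \<in> carrier R" "q \<in> carrier R" "x \<otimes> q = \<one> \<oplus> (x \<otimes> w \<ominus> w)"
    "\<And>V. V \<in> X \<Longrightarrow> x \<in> V \<Longrightarrow> w \<in> V \<and> \<one> \<ominus> w \<in> max_ideal R V \<and> q \<in> V \<and> q \<notin> max_ideal R V"
    "\<And>V. V \<in> X \<Longrightarrow> x \<notin> V \<Longrightarrow> w \<in> max_ideal R V \<and> x \<otimes> w \<in> max_ideal R V"
proof -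
  have tc: "t \<in> carrier R" using t J_subset_A A_carrier by blast
  obtain m :: nat where m: "\<And>V. V \<in> X \<Longrightarrow> x \<notin> V \<Longrightarrow> t \<otimes> x [^] m \<notin> V"
    using uniform_pole[OF tc t(2) x] by blast
  define d where "d = \<one> \<oplus> t \<otimes> x [^] Suc m"
  define n where "n = \<one> \<oplus> t \<otimes> x [^] m"
  have c: "d \<in> carrier R" "n \<in> carrier R" using tc x by (simp_all add: d_def n_def)
  have in_V: "d \<in> V \<and> d \<notin> max_ideal R V \<and> n \<in> V \<and> n \<notin> max_ideal R V \<and> d \<noteq> \<zero> \<and> inv d \<in> V"
    if V: "V \<in> X" "x \<in> V" for V
  proof -
    interpret V: valuation_subring R V using V by (intro member_valuation)
    have "t \<in> V.M" using t V by blast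
    then show ?thesis
      using V.denominator_unit[of t x] V V.unit[of d] unfolding d_def n_def by blast
  qed
  have notin_V: "d \<noteq> \<zero> \<and> inv d \<in> max_ideal R V \<and> x \<otimes> inv d \<in> max_ideal R V"
    if V: "V \<in> X" "x \<notin> V" for V
  proof -
    interpret V: valuation_subring R V using V by (intro member_valuation)
    have "t \<in> V.M" using t V by blast
    then show ?thesis
      using V.denominator_pole[of t x m] V m[OF V] x unfolding d_def by blast
  qed
  have d0: "d \<noteq> \<zero>" using nonempty in_V notin_V by blast
  have "x \<otimes> n = d \<oplus> (x \<ominus> \<one>)"
  proof -
    have "d = \<one> \<oplus> x \<otimes> (t \<otimes> x [^] m)" using tc x by (simp add: d_def m_ac)
    moreover have "x \<otimes> n = x \<oplus> x \<otimes> (t \<otimes> x [^] m)" using tc x by (simp add: n_def r_distr)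
    ultimately show ?thesis using tc x by (simp add: minus_eq a_ac r_neg1 r_neg2)
  qed
  then have "x \<otimes> (n \<otimes> inv d) = (d \<oplus> (x \<ominus> \<one>)) \<otimes> inv d"
    using c d0 x by (simp add: m_assoc[symmetric])
  also have "\<dots> = \<one> \<oplus> (x \<otimes> inv d \<ominus> inv d)"
    using c d0 x by (simp add: l_distr minus_eq l_minus)
  finally show thesis
  proof (rule that[rotated 2])
    fix V assume V: "V \<in> X"
    then interpret V: valuation_subring R V by (rule member_valuation)
    show "inv d \<in> V \<and> \<one> \<ominus> inv d \<in> V.M \<and> n \<otimes> inv d \<in> V \<and> n \<otimes> inv d \<notin> V.M" if "x \<in> V"
    proof (intro conjI)
      note d = in_V[OF V that]
      show dV: "inv d \<in> V" using d by blast
      show "n \<otimes> inv d \<in> V" using d by simp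
      have "t \<in> V.M" using t V by blast
      then have "t \<otimes> x [^] Suc m \<otimes> inv d \<in> V.M" using that dV by simp
      moreover have "t \<otimes> x [^] Suc m \<otimes> inv d = \<one> \<ominus> inv d"
      proof -
        have "t \<otimes> x [^] Suc m = d \<ominus> \<one>"
          using tc x by (simp add: d_def minus_eq a_ac r_neg1 r_neg2)
        then show ?thesis using c d0 by (simp add: minus_eq l_distr l_minus)
      qed
      ultimately show "\<one> \<ominus> inv d \<in> V.M" by simp
      show "n \<otimes> inv d \<notin> V.M"
      proof
        assume "n \<otimes> inv d \<in> V.M"
        then have "d \<otimes> (n \<otimes> inv d) \<in> V.M" using d by simp
        moreover have "d \<otimes> (n \<otimes> inv d) = n" using c d0 by (simp add: m_lcomm[of d n])
        ultimately show False using d by simp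
      qed
    qed
    show "inv d \<in> V.M \<and> x \<otimes> inv d \<in> V.M" if "x \<notin> V"
      using notin_V[OF V that] by blast
  qed (use c d0 in simp_all)
qed

section \<open>Comaximality and greatest common divisors in the intersection\<close>

text \<open>
  The image of \<open>A\<close> modulo \<open>J\<close> is von Neumann regular: the conclusion says \<open>a (1 - a b) \<in> J\<close>, as the
  maximal ideals are prime. For \<open>a \<noteq> 0\<close> and \<open>x = 1 / a\<close> the element \<open>b = x w\<close> works because \<open>a b = w\<close>
  indicates the rings in which \<open>a\<close> is a unit.
\<close>

lemma regular_modulo_J:
  assumes t: "t \<in> J" "t \<noteq> \<zero>" and a: "a \<in> A"
  obtains b where "b \<in> A" "\<And>V. V \<in> X \<Longrightarrow> a \<in> max_ideal R V \<or> \<one> \<ominus> a \<otimes> b \<in> max_ideal R V"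
proof (cases "a = \<zero>")
  case True
  then show thesis
    using that[of \<zero>] A_closed(1) valuation_subring.zero_M[OF member_valuation] by auto
next
  case False
  have ac: "a \<in> carrier R" using a by (rule A_carrier)
  define x where "x = inv a"
  have x: "x \<in> carrier R" "x \<noteq> \<zero>" "inv x = a" "a \<otimes> x = \<one>" using ac False by (simp_all add: x_def)
  obtain w q where w: "w \<in> carrier R"
    "\<And>V. V \<in> X \<Longrightarrow> x \<in> V \<Longrightarrow> w \<in> V \<and> \<one> \<ominus> w \<in> max_ideal R V"
    "\<And>V. V \<in> X \<Longrightarrow> x \<notin> V \<Longrightarrow> w \<in> max_ideal R V \<and> x \<otimes> w \<in> max_ideal R V"
    using approximate_indicator[OF t x(1)] by metis
  have aw: "a \<otimes> (x \<otimes> w) = w" using ac x w(1) by (simp add: m_assoc[symmetric])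
  have "x \<otimes> w \<in> V \<and> (a \<in> max_ideal R V \<or> \<one> \<ominus> a \<otimes> (x \<otimes> w) \<in> max_ideal R V)" if V: "V \<in> X" for V
  proof -
    interpret V: valuation_subring R V using V by (rule member_valuation)
    show ?thesis
    proof (cases "x \<in> V")
      case True
      then show ?thesis using w(2)[OF V] aw by auto
    next
      case False
      then show ?thesis using w(3)[OF V] V.notin_V[of x] x by auto
    qed
  qed
  then show thesis using that[of "x \<otimes> w"] by blast
qed

text \<open>
  By regularity there are \<open>p'\<close>, \<open>q'\<close> such that \<open>e = 1 - p p'\<close> vanishes modulo \<open>M\<^sub>V\<close> wherever \<open>p\<close> is a
  unit and \<open>f = 1 - q q'\<close> wherever \<open>q\<close> is. So \<open>e f \<in> J\<close>, and \<open>u = 1 - e f\<close> is a combination of \<open>p\<close> and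
  \<open>q\<close> that is a unit in every ring of the family, hence in \<open>A\<close>.
\<close>

lemma comaximal:
  assumes t: "t \<in> J" "t \<noteq> \<zero>" and p: "p \<in> A" and q: "q \<in> A"
    and pq: "\<And>V. V \<in> X \<Longrightarrow> p \<notin> max_ideal R V \<or> q \<notin> max_ideal R V"
  obtains r s where "r \<in> A" "s \<in> A" "r \<otimes> p \<oplus> s \<otimes> q = \<one>"
proof -
  obtain p' where p': "p' \<in> A" "\<And>V. V \<in> X \<Longrightarrow> p \<in> max_ideal R V \<or> \<one> \<ominus> p \<otimes> p' \<in> max_ideal R V"
    using regular_modulo_J[OF t p] by blast
  obtain q' where q': "q' \<in> A" "\<And>V. V \<in> X \<Longrightarrow> q \<in> max_ideal R V \<or> \<one> \<ominus> q \<otimes> q' \<in> max_ideal R V"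
    using regular_modulo_J[OF t q] by blast
  define e where "e = \<one> \<ominus> p \<otimes> p'"
  define f where "f = \<one> \<ominus> q \<otimes> q'"
  define u where "u = \<one> \<oplus> \<ominus> (e \<otimes> f)"
  have ef: "e \<in> A" "f \<in> A" unfolding e_def f_def minus_eq using p q p'(1) q'(1) A_closed by metis+
  note c = A_carrier[OF p] A_carrier[OF q] A_carrier[OF p'(1)] A_carrier[OF q'(1)]
    A_carrier[OF ef(1)] A_carrier[OF ef(2)]
  have u: "u \<noteq> \<zero> \<and> inv u \<in> V" if V: "V \<in> X" for V
  proof -
    interpret V: valuation_subring R V using V by (rule member_valuation)
    have efV: "e \<in> V" "f \<in> V" using ef V by blast+
    have "e \<in> V.M \<or> f \<in> V.M" using p'(2)[OF V] q'(2)[OF V] pq[OF V] by (auto simp: e_def f_def)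
    then have "e \<otimes> f \<in> V.M" using efV by auto
    then have "\<ominus> (e \<otimes> f) \<in> V.M" by (rule V.M_minus)
    then have "u \<in> V" "u \<notin> V.M" using V.one_plus_M by (auto simp: u_def)
    then show ?thesis by (rule V.unit)
  qed
  then have u0: "u \<noteq> \<zero>" and iu: "inv u \<in> A" using nonempty by blast+
  have uc: "u \<in> carrier R" "inv u \<in> carrier R" using c u0 by (auto simp: u_def)
  have "u = p' \<otimes> p \<oplus> (q' \<otimes> e) \<otimes> q"
  proof -
    have "e = \<one> \<oplus> \<ominus> (p \<otimes> p')" by (simp add: e_def minus_eq)
    have "e \<otimes> f = e \<oplus> \<ominus> (e \<otimes> (q \<otimes> q'))"
      using c by (simp add: f_def minus_eq r_distr r_minus)
    then have "u = (\<one> \<oplus> \<ominus> e) \<oplus> e \<otimes> (q \<otimes> q')"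
      using c by (simp add: u_def minus_add a_assoc)
    moreover have "\<one> \<oplus> \<ominus> e = p' \<otimes> p"
      using c by (simp add: e_def minus_eq minus_add r_neg2 m_comm)
    ultimately show ?thesis using c by (simp add: m_ac)
  qed
  then have "(inv u \<otimes> p') \<otimes> p \<oplus> (inv u \<otimes> (q' \<otimes> e)) \<otimes> q = inv u \<otimes> u"
    using c uc by (simp add: r_distr m_assoc del: inv_nonzero(3,4))
  then show thesis
    using that[of "inv u \<otimes> p'" "inv u \<otimes> (q' \<otimes> e)"] iu p' q' ef u0 uc A_closed by simp
qed

text \<open>
  For \<open>b \<noteq> 0\<close> the elements \<open>q\<close> (obtained from \<open>x = a / b\<close>) and \<open>p = x q\<close> are never both in \<open>M\<^sub>V\<close>: where
  \<open>x\<close> is integral, \<open>q\<close> is a unit, and where \<open>x\<close> has a pole, \<open>p\<close> is. Thus \<open>r p + s q = 1\<close> can be solved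
  in \<open>A\<close>, and \<open>p b = q a\<close> shows that \<open>p\<close> and \<open>q\<close> are the cofactors of \<open>r a + s b\<close>.
\<close>

lemma gcd_exists:
  assumes t: "t \<in> J" "t \<noteq> \<zero>" and a: "a \<in> A" and b: "b \<in> A"
  obtains r s p q where "r \<in> A" "s \<in> A" "p \<in> A" "q \<in> A"
    "a = p \<otimes> (r \<otimes> a \<oplus> s \<otimes> b)" "b = q \<otimes> (r \<otimes> a \<oplus> s \<otimes> b)"
proof (cases "b = \<zero>")
  case True
  then show thesis
    using that[of \<one> \<zero> \<one> \<zero>] A_carrier[OF a] A_closed(1,2) by simp
next
  case False
  have ac: "a \<in> carrier R" "b \<in> carrier R" using a b A_carrier by blast+
  define x where "x = a \<otimes> inv b"
  have x: "x \<in> carrier R" "x \<otimes> b = a" using ac False by (simp_all add: x_def m_assoc)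
  obtain w q where w: "w \<in> carrier R" "q \<in> carrier R" "x \<otimes> q = \<one> \<oplus> (x \<otimes> w \<ominus> w)"
    "\<And>V. V \<in> X \<Longrightarrow> x \<in> V \<Longrightarrow> w \<in> V \<and> \<one> \<ominus> w \<in> max_ideal R V \<and> q \<in> V \<and> q \<notin> max_ideal R V"
    "\<And>V. V \<in> X \<Longrightarrow> x \<notin> V \<Longrightarrow> w \<in> max_ideal R V \<and> x \<otimes> w \<in> max_ideal R V"
    using approximate_indicator[OF t x(1)] by metis
  define p where "p = x \<otimes> q"
  have pc: "p \<in> carrier R" using x w by (simp add: p_def)
  have *: "p \<in> V \<and> q \<in> V \<and> (p \<notin> max_ideal R V \<or> q \<notin> max_ideal R V)" if V: "V \<in> X" for V
  proof -
    interpret V: valuation_subring R V using V by (rule member_valuation)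
    show ?thesis
    proof (cases "x \<in> V")
      case True
      then show ?thesis using w(4)[OF V] by (simp add: p_def)
    next
      case False
      then have x0: "x \<noteq> \<zero>" "inv x \<in> V" using V.notin_V[of x] x by auto
      have "x \<otimes> w \<ominus> w \<in> V.M"
        using w(5)[OF V False] V.M_minus by (simp add: minus_eq)
      then have pV: "p \<in> V" "p \<notin> V.M" using V.one_plus_M w(3) by (auto simp: p_def)
      then have "inv x \<otimes> p \<in> V" using x0 by simp
      moreover have "inv x \<otimes> p = q" unfolding p_def by (rule inv_cancel) (use x x0 w in auto)
      ultimately show ?thesis using pV by simp
    qed
  qed
  then have pq: "p \<in> A" "q \<in> A" by blast+
  obtain r s where rs: "r \<in> A" "s \<in> A" "r \<otimes> p \<oplus> s \<otimes> q = \<one>"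
    using comaximal[OF t pq] * by blast
  have c: "r \<in> carrier R" "s \<in> carrier R" using rs A_carrier by blast+
  have swap: "p \<otimes> b = q \<otimes> a" using x w ac by (simp add: p_def m_ac flip: x(2))
  have "p \<otimes> (r \<otimes> a \<oplus> s \<otimes> b) = (r \<otimes> p) \<otimes> a \<oplus> s \<otimes> (p \<otimes> b)"
    using c pc ac by (simp add: r_distr m_ac)
  also have "\<dots> = (r \<otimes> p \<oplus> s \<otimes> q) \<otimes> a"
    unfolding swap using c pc w(1,2) ac by (simp add: l_distr r_distr m_ac)
  finally have 1: "a = p \<otimes> (r \<otimes> a \<oplus> s \<otimes> b)" using rs ac by simp
  have "q \<otimes> (r \<otimes> a \<oplus> s \<otimes> b) = r \<otimes> (q \<otimes> a) \<oplus> (s \<otimes> q) \<otimes> b"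
    using c w ac by (simp add: r_distr m_ac)
  also have "\<dots> = (r \<otimes> p \<oplus> s \<otimes> q) \<otimes> b"
    unfolding swap[symmetric] using c pc w(1,2) ac by (simp add: l_distr r_distr m_ac)
  finally have 2: "b = q \<otimes> (r \<otimes> a \<oplus> s \<otimes> b)" using rs ac by simp
  show thesis by (rule that[OF rs(1,2) pq 1 2])
qed

lemma A_domain: "domain (subring_of R A)"
  by (rule subring_is_domain[OF A_subring])

lemma fin_gen_imp_principal:
  assumes t: "t \<in> J" "t \<noteq> \<zero>" and I: "fin_gen_ideal I (subring_of R A)"
  shows "principalideal I (subring_of R A)"
proof -
  interpret D: domain "subring_of R A" by (rule A_domain)
  obtain S where S: "finite S" "S \<subseteq> A" "I = Idl\<^bsub>subring_of R A\<^esub> S"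
    using I by (auto simp: fin_gen_ideal_def)
  have "\<exists>g\<in>Idl\<^bsub>subring_of R A\<^esub> S. \<forall>s\<in>S. \<exists>z\<in>A. s = z \<otimes> g" using S(1,2)
  proof (induction S)
    case empty
    have "ideal (Idl\<^bsub>subring_of R A\<^esub> {}) (subring_of R A)" by (rule D.genideal_ideal) simp
    then interpret i: ideal "Idl\<^bsub>subring_of R A\<^esub> {}" "subring_of R A" .
    show ?case using additive_subgroup.zero_closed[OF i.is_additive_subgroup] by auto
  next
    case (insert a S)
    then obtain b where b: "b \<in> Idl\<^bsub>subring_of R A\<^esub> S" "\<And>s. s \<in> S \<Longrightarrow> \<exists>z\<in>A. s = z \<otimes> b"
      by auto
    have aS: "insert a S \<subseteq> carrier (subring_of R A)" using insert by simp
    have "ideal (Idl\<^bsub>subring_of R A\<^esub> S) (subring_of R A)" by (rule D.genideal_ideal) (use aS in simp)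
    from ideal.Icarr[OF this b(1)] have bA: "b \<in> A" by simp
    interpret i: ideal "Idl\<^bsub>subring_of R A\<^esub> (insert a S)" "subring_of R A"
      by (rule D.genideal_ideal[OF aS])
    have aA: "a \<in> A" using insert by blast
    have aI: "a \<in> Idl\<^bsub>subring_of R A\<^esub> (insert a S)" using D.genideal_self[OF aS] by blast
    have bI: "b \<in> Idl\<^bsub>subring_of R A\<^esub> (insert a S)"
      using D.subset_Idl_subset[OF aS, of S] b by blast
    obtain r s p q where g: "r \<in> A" "s \<in> A" "p \<in> A" "q \<in> A"
      "a = p \<otimes> (r \<otimes> a \<oplus> s \<otimes> b)" "b = q \<otimes> (r \<otimes> a \<oplus> s \<otimes> b)"
      using gcd_exists[OF t aA bA] by blast
    define g where "g = r \<otimes> a \<oplus> s \<otimes> b"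
    have gI: "g \<in> Idl\<^bsub>subring_of R A\<^esub> (insert a S)"
      using i.a_closed[OF i.I_l_closed[OF aI] i.I_l_closed[OF bI], of r s] g by (simp add: g_def)
    then have gA: "g \<in> carrier R" using i.Icarr A_carrier by force
    have "\<exists>z\<in>A. y = z \<otimes> g" if y: "y \<in> insert a S" for y
    proof (cases "y = a")
      case True
      then show ?thesis using g by (auto simp: g_def)
    next
      case False
      then obtain z where z: "z \<in> A" "y = z \<otimes> b" using y b(2)[of y] False by blast
      then have "y = (z \<otimes> q) \<otimes> g"
        using g(6) A_carrier g(4) gA by (metis g_def m_assoc)
      then show ?thesis using z g A_closed by blast
    qed
    then show ?case using gI by blast
  qed
  then obtain g where g: "g \<in> Idl\<^bsub>subring_of R A\<^esub> S" "\<And>s. s \<in> S \<Longrightarrow> \<exists>z\<in>A. s = z \<otimes> g" by blast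
  have id: "ideal (Idl\<^bsub>subring_of R A\<^esub> S) (subring_of R A)" by (rule D.genideal_ideal) (use S in simp)
  have gA: "g \<in> carrier (subring_of R A)" by (rule ideal.Icarr[OF id g(1)])
  interpret i: ideal "Idl\<^bsub>subring_of R A\<^esub> {g}" "subring_of R A"
    by (rule D.genideal_ideal) (use gA in simp)
  have "Idl\<^bsub>subring_of R A\<^esub> S \<subseteq> Idl\<^bsub>subring_of R A\<^esub> {g}"
  proof (rule D.genideal_minimal[OF i.is_ideal], rule subsetI)
    fix s assume "s \<in> S"
    then obtain z where "z \<in> A" "s = z \<otimes> g" using g by blast
    then show "s \<in> Idl\<^bsub>subring_of R A\<^esub> {g}"
      using i.I_l_closed[OF D.genideal_self'[OF gA], of z] by simp
  qed
  moreover have "Idl\<^bsub>subring_of R A\<^esub> {g} \<subseteq> Idl\<^bsub>subring_of R A\<^esub> S"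
    by (rule D.genideal_minimal[OF id]) (use g in simp)
  ultimately have "I = Idl\<^bsub>subring_of R A\<^esub> {g}" using S by blast
  then show ?thesis using principalidealI[OF i.is_ideal] gA by auto
qed

section \<open>Quotient field and prime ideals of the intersection\<close>

lemma quotient_field:
  assumes t: "t \<in> J" "t \<noteq> \<zero>"
  shows "has_quotient_field A R"
proof -
  have tA: "t \<in> A" using t J_subset_A by blast
  have "x \<in> {a \<otimes> inv b | a b. a \<in> A \<and> b \<in> A \<and> b \<noteq> \<zero>}" if x: "x \<in> carrier R" for x
  proof -
    obtain n :: nat where n: "t [^] n \<otimes> x \<in> A" using power_clears_denominator[OF t x] by blast
    have tn: "t [^] n \<in> A" using tA by (rule A_pow)
    have "t [^] n \<noteq> \<zero>" "x = (t [^] n \<otimes> x) \<otimes> inv (t [^] n)"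
      using nat_pow_nonzero[OF A_carrier[OF tA] t(2)] A_carrier[OF tn] x
      by (simp_all add: m_comm[of "t [^] n" x] m_assoc)
    then show ?thesis using n tn by blast
  qed
  moreover have "a \<otimes> inv b \<in> carrier R" if "a \<in> A" "b \<in> A" "b \<noteq> \<zero>" for a b
    using that A_carrier by simp
  ultimately show ?thesis
    unfolding has_quotient_field_def using field_axioms A_subring by blast
qed

text \<open>
  For \<open>0 \<noteq> p \<in> P\<close> a suitable power of \<open>t \<in> J\<close> is a multiple of \<open>p\<close> in \<open>A\<close>, because it clears the
  denominator of \<open>1 / p\<close>.
\<close>

lemma J_subset_prime:
  assumes P: "primeideal P (subring_of R A)" "P \<noteq> {\<zero>}"
  shows "J \<subseteq> P"
proof
  fix t assume t: "t \<in> J"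
  interpret P: primeideal P "subring_of R A" by (rule P)
  have tA: "t \<in> A" using t J_subset_A by blast
  show "t \<in> P"
  proof (cases "t = \<zero>")
    case True
    then show ?thesis using additive_subgroup.zero_closed[OF P.is_additive_subgroup] by simp
  next
    case False
    obtain p where p: "p \<in> P" "p \<noteq> \<zero>" using P(2) additive_subgroup.zero_closed[OF P.is_additive_subgroup] by auto
    then have pc: "p \<in> carrier R" using P.Icarr A_carrier by force
    obtain n :: nat where n: "t [^] n \<otimes> inv p \<in> A"
      using power_clears_denominator[OF t False, of "inv p"] pc p by auto
    have tn: "t [^] k \<in> A" for k :: nat using tA by (rule A_pow)
    have "(t [^] n \<otimes> inv p) \<otimes> p = t [^] n"
      using pc p A_carrier[OF tA] by (simp add: m_assoc)
    then have "t [^] n \<in> P" using P.I_l_closed[OF p(1), of "t [^] n \<otimes> inv p"] n by simp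
    moreover have "t [^] k \<in> P \<Longrightarrow> t \<in> P" for k :: nat
    proof (induction k)
      case 0
      then show ?case using P.one_imp_carrier P.I_notcarr by simp
    next
      case (Suc k)
      then show ?case using P.I_prime[of "t [^] k" t] tn tA by auto
    qed
    ultimately show ?thesis by blast
  qed
qed

text \<open>
  If \<open>a \<in> Q - P\<close>, then \<open>a (1 - a b) \<in> J \<subseteq> P\<close> for some \<open>b\<close>, so that \<open>1 - a b \<in> P \<subseteq> Q\<close> and \<open>1 \<in> Q\<close>.
\<close>

lemma nonzero_prime_maximal:
  assumes t: "t \<in> J" "t \<noteq> \<zero>"
    and P: "primeideal P (subring_of R A)" "P \<noteq> {\<zero>}"
    and Q: "primeideal Q (subring_of R A)" "P \<subseteq> Q"
  shows "P = Q"
proof (rule ccontr)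
  assume "P \<noteq> Q"
  interpret P: primeideal P "subring_of R A" by (rule P)
  interpret Q: primeideal Q "subring_of R A" by (rule Q)
  obtain a where a: "a \<in> Q" "a \<notin> P" using Q(2) \<open>P \<noteq> Q\<close> by blast
  then have aA: "a \<in> A" using Q.Icarr by simp
  obtain b where b: "b \<in> A" "\<And>V. V \<in> X \<Longrightarrow> a \<in> max_ideal R V \<or> \<one> \<ominus> a \<otimes> b \<in> max_ideal R V"
    using regular_modulo_J[OF t aA] by blast
  have c: "a \<in> carrier R" "b \<in> carrier R" using aA b A_carrier by blast+
  have eA: "\<one> \<ominus> a \<otimes> b \<in> A" using aA b(1) A_closed unfolding minus_eq by metis
  have "a \<otimes> (\<one> \<ominus> a \<otimes> b) \<in> J"
  proof
    fix V assume V: "V \<in> X"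
    interpret V: valuation_subring R V using V by (rule member_valuation)
    have "a \<in> V" "\<one> \<ominus> a \<otimes> b \<in> V" using aA eA V by blast+
    then show "a \<otimes> (\<one> \<ominus> a \<otimes> b) \<in> V.M" using b(2)[OF V] by auto
  qed
  then have "a \<otimes> (\<one> \<ominus> a \<otimes> b) \<in> P" using J_subset_prime[OF P] by blast
  then have "\<one> \<ominus> a \<otimes> b \<in> P" using P.I_prime[of a "\<one> \<ominus> a \<otimes> b"] aA eA a by auto
  then have "\<one> \<ominus> a \<otimes> b \<in> Q" using Q(2) by blast
  moreover have "a \<otimes> b \<in> Q" using Q.I_r_closed[OF a(1), of b] b by simp
  ultimately have "(\<one> \<ominus> a \<otimes> b) \<oplus> a \<otimes> b \<in> Q" using Q.a_closed by force
  moreover have "(\<one> \<ominus> a \<otimes> b) \<oplus> a \<otimes> b = \<one>" using c by (simp add: minus_eq a_assoc l_neg)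
  ultimately show False using Q.one_imp_carrier Q.I_notcarr by simp
qed

lemma krull_dim_A:
  assumes t: "t \<in> J" "t \<noteq> \<zero>"
  shows "krull_dim (subring_of R A) = 1"
proof (rule antisym)
  interpret D: domain "subring_of R A" by (rule A_domain)
  show "1 \<le> krull_dim (subring_of R A)"
  proof -
    obtain V where V: "V \<in> X" using nonempty by blast
    interpret V: valuation_subring R V using V by (rule member_valuation)
    have tA: "t \<in> A" using t J_subset_A by blast
    have "primeideal (V.M \<inter> A) (subring_of R A)"
    proof (rule subring_primeidealI[OF A_subring])
      show "x \<in> V.M \<inter> A \<or> y \<in> V.M \<inter> A" if "x \<in> A" "y \<in> A" "x \<otimes> y \<in> V.M \<inter> A" for x y
        using that V.prime_M[of x y] V by blast
      show "y \<otimes> x \<in> V.M \<inter> A" if "x \<in> V.M \<inter> A" "y \<in> A" for x y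
        using that V V.M_mult(2)[of x y] A_closed(4)[of y x] by blast
      show "x \<oplus> y \<in> V.M \<inter> A" if "x \<in> V.M \<inter> A" "y \<in> V.M \<inter> A" for x y
        using that V.M_add[of x y] A_closed(5)[of x y] by blast
      show "\<zero> \<in> V.M \<inter> A" using V.zero_M A_closed(1) by blast
      show "\<one> \<notin> V.M \<inter> A" using V.one_M by blast
    qed blast
    moreover have "{\<zero>} \<subset> V.M \<inter> A" using t tA V A_closed(1) V.zero_M by blast
    ultimately have "enat 1 \<le> krull_dim (subring_of R A)"
      using D.zeroprimeideal
      by (intro krull_dim_ge[where P = "\<lambda>i. if i = 0 then {\<zero>} else V.M \<inter> A"]) auto
    then show ?thesis by (simp add: one_enat_def)
  qed
  show "krull_dim (subring_of R A) \<le> 1"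
    unfolding krull_dim_def
  proof (rule Sup_least, clarify)
    fix n and P :: "nat \<Rightarrow> 'a set"
    assume P: "\<forall>i\<le>n. primeideal (P i) (subring_of R A)" "\<forall>i<n. P i \<subset> P (Suc i)"
    show "enat n \<le> 1"
    proof (rule ccontr)
      assume "\<not> enat n \<le> 1"
      then have n: "2 \<le> n" by (simp add: one_enat_def)
      then have 01: "P 0 \<subset> P 1" "P 1 \<subset> P 2" using P(2)
        by (auto simp: numeral_2_eq_2 dest: spec[of _ 0] spec[of _ 1])
      have pr: "primeideal (P 0) (subring_of R A)" "primeideal (P 1) (subring_of R A)"
        "primeideal (P 2) (subring_of R A)" using P(1) n by auto
      interpret P0: primeideal "P 0" "subring_of R A" by (rule pr)
      have "P 1 \<noteq> {\<zero>}" using additive_subgroup.zero_closed[OF P0.is_additive_subgroup] 01(1) by auto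
      then show False using nonzero_prime_maximal[OF t pr(2) _ pr(3)] 01 by blast
    qed
  qed
qed

end

section \<open>The principal ideal theorem\<close>

theorem mainTheorem1:
  fixes F :: "('a, 'b) ring_scheme" and X :: "'a set set"
  assumes "field F"
    and "X \<noteq> {}" and "X \<subseteq> Zar F"
    and "compact_space (subtopology (zariski_topology F) X)"
    and "\<forall>V\<in>X. rank_one_valuation_ring F V"
    and "(\<Inter>V\<in>X. max_ideal F V) \<noteq> {\<zero>\<^bsub>F\<^esub>}"
  shows "domain (subring_of F (\<Inter>V\<in>X. V))
    \<and> has_quotient_field (\<Inter>V\<in>X. V) F
    \<and> krull_dim (subring_of F (\<Inter>V\<in>X. V)) = 1
    \<and> (\<forall>I. fin_gen_ideal I (subring_of F (\<Inter>V\<in>X. V))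
          \<longrightarrow> principalideal I (subring_of F (\<Inter>V\<in>X. V)))"
proof -
  interpret field F by fact
  interpret rank_one_family F X
  proof
    show "compactin (zariski_topology F) X"
      using assms(3,4) by (simp add: compactin_subspace topspace_zariski_topology)
  qed (use assms in auto)
  have "\<zero>\<^bsub>F\<^esub> \<in> J" using valuation_subring.zero_M[OF member_valuation] by blast
  then obtain t where t: "t \<in> J" "t \<noteq> \<zero>\<^bsub>F\<^esub>" using assms(6) by blast
  show ?thesis
    using A_domain quotient_field[OF t] krull_dim_A[OF t] fin_gen_imp_principal[OF t] by simp
qed

end
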